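(* Let $\alpha$ be a fixed nonzero point of $L$ and let $c_1,c_2,c_3,\dots$ be complex numbers with $c_1\neq0$, and let $F$ be the function defined in the context. For integers $1\le a\le M$ and complex numbers $x_1,\dots,x_M$, \[ \sum_{s\in S(M,a)}\ \prod_{i=1}^a F\Big(\sum_{m\in s_i}x_m,\ |s_i|-1,\ 1\Big)=F\Big(\sum_{i=1}^M x_i,\ M-1,\ a\Big). \]
   Context: $L$ is the Riemann surface of the logarithm, parametrized by triples $(r,\theta,n)$ with $r>0$, $\theta\in(-\pi,\pi]$, $n\in\mathbb{Z}$; for $z=(r,\theta,n)\in L$ and $\gamma\in\mathbb{C}$, $z^\gamma=e^{\gamma\ln r+i\gamma\theta+2\pi i n\gamma}$. $S(M,a)$ is the set of set partitions $s=(s_1,\dots,s_a)$ of $\{1,\dots,M\}$ into $a$ nonempty pairwise disjoint blocks, ordered so that $\min s_i<\min s_j$ for $i<j$. For an integer $r\ge 0$, $C(r)$ is the set of sequences $\mu=(\mu_i)_{i\ge 1}$ of nonnegative integers, eventually zero, with $\sum_{i\ge1}\mu_i=r$. For $x\in\mathbb{C}$ and integer $n$, $\binom{x}{n}=\frac{x(x-1)\cdots(x-n+1)}{n!}$ for $n\ge 0$ and $\binom{x}{n}=0$ for $n<0$. For $x\in\mathbb{C}$ and integers $r\ge 0$, $a\ge 1$, \[ F(x,r,a)=\frac{-\alpha^{x}}{(a-1)!}\sum_{\mu\in C(r)}(-1)^{\mu_1}\binom{x}{\,r-\sum_{i\ge2}(i-1)\mu_i-(a-1)\,}\Big(r+\sum_{i\ge2}\mu_i\Big)!\,\frac{\alpha^{-(r-\sum_{i\ge2}(i-1)\mu_i-(a-1))}}{c_1^{\,r+1+\sum_{i\ge2}\mu_i}}\prod_{i\ge2}\frac{c_i^{\mu_i}}{\mu_i!},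 \] with powers of $\alpha$ taken in the sense of $L$. *)

theory Defs
  imports "HOL-Analysis.Analysis"
begin

text \<open>Points of the Riemann surface of the logarithm: triples (r, theta, n)
  with r > 0, theta in (-pi, pi], n an integer.\<close>
type_synonym Lpt = "real \<times> real \<times> int"

definition in_L :: "Lpt \<Rightarrow> bool" where
  "in_L z \<longleftrightarrow> (case z of (r, \<theta>, n) \<Rightarrow> r > 0 \<and> -pi < \<theta> \<and> \<theta> \<le> pi)"

definition Lpow :: "Lpt \<Rightarrow> complex \<Rightarrow> complex" where
  "Lpow z \<gamma> = (case z of (r, \<theta>, n) \<Rightarrow>
     exp (\<gamma> * of_real (ln r) + \<i> * \<gamma> * of_real \<theta> + 2 * of_real pi * \<i> * of_int n * \<gamma>))"

definition gbinom :: "complex \<Rightarrow> int \<Rightarrow> complex" where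
  "gbinom x k = (if k < 0 then 0 else x gchoose (nat k))"

text \<open>C(r): sequences (mu_i)_{i>=1} of nonnegative integers, eventually zero, summing to r.
  Represented as functions nat => nat with mu 0 = 0 (index 0 unused).\<close>
definition Cseq :: "nat \<Rightarrow> (nat \<Rightarrow> nat) set" where
  "Cseq r = {\<mu>. \<mu> 0 = 0 \<and> finite {i. \<mu> i \<noteq> 0} \<and> (\<Sum>i\<in>{i. \<mu> i \<noteq> 0}. \<mu> i) = r}"

definition supp2 :: "(nat \<Rightarrow> nat) \<Rightarrow> nat set" where
  "supp2 \<mu> = {i. 2 \<le> i \<and> \<mu> i \<noteq> 0}"

definition Fterm :: "Lpt \<Rightarrow> (nat \<Rightarrow> complex) \<Rightarrow> complex \<Rightarrow> nat \<Rightarrow> nat \<Rightarrow> (nat \<Rightarrow> nat) \<Rightarrow> complex" where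
  "Fterm \<alpha> c x r a \<mu> =
     (let k = int r - (\<Sum>i\<in>supp2 \<mu>. (int i - 1) * int (\<mu> i)) - (int a - 1);
          s = (\<Sum>i\<in>supp2 \<mu>. \<mu> i)
      in (-1) ^ (\<mu> 1) * gbinom x k * of_nat (fact (r + s))
         * Lpow \<alpha> (- of_int k) / (c 1) ^ (r + 1 + s)
         * (\<Prod>i\<in>supp2 \<mu>. (c i) ^ (\<mu> i) / of_nat (fact (\<mu> i))))"

definition F :: "Lpt \<Rightarrow> (nat \<Rightarrow> complex) \<Rightarrow> complex \<Rightarrow> nat \<Rightarrow> nat \<Rightarrow> complex" where
  "F \<alpha> c x r a = - Lpow \<alpha> x / of_nat (fact (a - 1)) * (\<Sum>\<^sub>\<infinity>\<mu>\<in>Cseq r. Fterm \<alpha> c x r a \<mu>)"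

text \<open>S(M,a): set partitions of {1..M} into a nonempty pairwise disjoint blocks,
  listed as (s_1,...,s_a) = (ss!0,...,ss!(a-1)) with strictly increasing minima.\<close>
definition Spart :: "nat \<Rightarrow> nat \<Rightarrow> nat set list set" where
  "Spart M a = {ss. length ss = a
      \<and> (\<forall>i<a. ss ! i \<noteq> {})
      \<and> (\<forall>i<a. \<forall>j<a. i \<noteq> j \<longrightarrow> ss ! i \<inter> ss ! j = {})
      \<and> \<Union>(set ss) = {1..M}
      \<and> (\<forall>i<a. \<forall>j<a. i < j \<longrightarrow> Min (ss ! i) < Min (ss ! j))}"

end

theory Submission
  imports Defs "HOL-Computational_Algebra.Formal_Power_Series"
begin

text \<open>
  Put \<open>\<phi>(w) = (\<Sum>i\<ge>1. c\<^sub>i w\<^sup>i)\<close> and \<open>h\<^sub>m(w) = - (\<alpha> + w)\<^bsup>x m\<^esup> \<cdot> w / \<phi>(w)\<close>. Expanding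
  \<open>(w / \<phi>(w))\<^bsup>r+1\<^esup>\<close> by the negative binomial series and the multinomial theorem shows that,
  for a finite set \<open>B\<close> of indices,
  \<open>F (\<Sum>m\<in>B. x m) (|B| - 1) a = (|B| - 1)! / (a - 1)! \<cdot> [w\<^bsup>|B| - a\<^esup>] (\<Prod>m\<in>B. h\<^sub>m)\<close>.

  The theorem then is an identity for arbitrary power series \<open>h\<^sub>m\<close>, a polarized form of
  Lagrange inversion. Let \<open>W\<^sub>a(B) = a (|B| - 1)! [w\<^bsup>|B| - a\<^esup>] (\<Prod>m\<in>B. h\<^sub>m)\<close>. The Leibniz rule for
  \<open>w d/dw\<close> gives the recursion
  \<open>W\<^bsub>a+1\<^esub>(B) = (\<Sum>m\<in>B. \<Sum>d. [w\<^sup>d] h\<^sub>m \<cdot> W\<^bsub>a+d\<^esub>(B - {m}))\<close>, from which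
  \<open>(\<Sum>S\<subseteq>B. W\<^sub>a(S) W\<^sub>b(B - S)) = W\<^bsub>a+b\<^esub>(B)\<close> follows by induction on \<open>|B|\<close>. Restricting to the
  sets \<open>S\<close> that contain a fixed point of \<open>B\<close> yields the sum over set partitions block by block.
\<close>

section \<open>Forest weights\<close>

lemma fps_deriv_prod:
  fixes h :: "'i \<Rightarrow> 'a::comm_ring_1 fps"
  shows "fps_deriv (\<Prod>m\<in>B. h m) = (\<Sum>m\<in>B. fps_deriv (h m) * (\<Prod>k\<in>B-{m}. h k))"
proof (induction B rule: infinite_finite_induct)
  case (insert b B)
  have "(\<Prod>k\<in>insert b B - {m}. h k) = h b * (\<Prod>k\<in>B-{m}. h k)" if "m \<in> B" for m
  proof -
    have "insert b B - {m} = insert b (B - {m})" using that insert by auto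
    then show ?thesis using insert by simp
  qed
  moreover have "insert b B - {b} = B" using insert by auto
  ultimately show ?case
    using insert by (simp add: sum_distrib_left algebra_simps)
qed auto

text \<open>
  For \<open>h m = (\<Sum>d. t\<^sub>d w\<^sup>d / d!)\<close> this is \<open>a!\<close> times the generating function, by out-degrees, of
  the forests of \<open>a\<close> rooted trees on the vertex set \<open>B\<close>.
\<close>
definition forest_weight :: "('i \<Rightarrow> 'a::comm_ring_1 fps) \<Rightarrow> nat \<Rightarrow> 'i set \<Rightarrow> 'a" where
  "forest_weight h a B =
     (if B = {} then of_bool (a = 0)
      else if a \<le> card B
        then of_nat (a * fact (card B - 1)) * fps_nth (\<Prod>m\<in>B. h m) (card B - a)
      else 0)"

lemma forest_weight_empty: "forest_weight h a {} = of_bool (a = 0)"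
  by (simp add: forest_weight_def)

lemma forest_weight_0: "forest_weight h 0 B = of_bool (B = {})"
  by (simp add: forest_weight_def)

text \<open>In terms of forests, the first of \<open>a + 1\<close> ordered roots is some
  \<open>m\<close>, and deleting it turns its \<open>d\<close> children into roots. The proof is
  purely algebraic and rests on the Leibniz rule for \<open>fps_XD\<close>. The bound
  \<open>N\<close> is left free so that one range of \<open>d\<close> can serve many sets at
  once.\<close>

lemma forest_weight_Suc:
  fixes h :: "'i \<Rightarrow> 'a::comm_ring_1 fps"
  assumes "finite B" "card B \<le> N"
  shows "forest_weight h (Suc a) B =
    (\<Sum>m\<in>B. \<Sum>d\<le>N. fps_nth (h m) d * forest_weight h (a + d) (B - {m}))"
proof -
  \<comment> \<open>For a singleton the set \<open>B - {m}\<close> is empty and falls under the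
    special clause of \<open>forest_weight\<close>; the generic computation starts at two elements,
    where \<open>M - 2\<close> is a true difference.\<close>
  consider "B = {}" | m where "B = {m}" | "card B \<ge> 2"
  proof -
    have "card B = 0 \<or> card B = 1 \<or> card B \<ge> 2" by linarith
    then show ?thesis using assms(1) that by (auto simp: card_1_singleton_iff)
  qed
  then show ?thesis
  proof cases
    case 1
    then show ?thesis by (simp add: forest_weight_empty)
  next
    case 2
    have "(\<Sum>d\<le>N. fps_nth (h m) d * of_bool (a + d = 0)) =
          (\<Sum>d\<in>{0}. fps_nth (h m) d * of_bool (a + d = 0))"
      by (rule sum.mono_neutral_right) auto
    with 2 show ?thesis by (auto simp: forest_weight_def)
  next
    case 3
    define M where "M = card B"
    have cardm: "card (B - {m}) = M - 1" "B - {m} \<noteq> {}" if "m \<in> B" for m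
    proof -
      show "card (B - {m}) = M - 1" using that assms(1) by (simp add: M_def)
      then show "B - {m} \<noteq> {}" using 3 M_def by (intro notI) simp
    qed
    show ?thesis
    proof (cases "Suc a \<le> M")
      case False
      then have "forest_weight h (a + d) (B - {m}) = 0" if "m \<in> B" for m d
        using that 3 cardm[OF that] by (simp add: forest_weight_def M_def)
      moreover have "forest_weight h (Suc a) B = 0"
        using False 3 by (auto simp: forest_weight_def M_def)
      ultimately show ?thesis by simp
    next
      case True
      define k where "k = M - 1 - a"
      define P where "P = (\<Prod>m\<in>B. h m)"
      define Q where "Q m = (\<Prod>j\<in>B-{m}. h j)" for m
      have hQ: "h m * Q m = P" if "m \<in> B" for m
        using that assms(1) by (simp add: P_def Q_def prod.remove[of B m])
      have inner: "(\<Sum>d\<le>N. fps_nth (h m) d * forest_weight h (a + d) (B - {m}))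
          = of_nat (fact (M - 2)) * (of_nat a * fps_nth P k + fps_nth (fps_XD (h m) * Q m) k)"
        if m: "m \<in> B" for m
      proof -
        have "(\<Sum>d\<le>N. fps_nth (h m) d * forest_weight h (a + d) (B - {m})) =
              (\<Sum>d\<in>{0..k}. fps_nth (h m) d * forest_weight h (a + d) (B - {m}))"
        proof (rule sum.mono_neutral_right)
          show "{0..k} \<subseteq> {..N}" using assms(2) by (auto simp: k_def M_def)
          show "\<forall>d\<in>{..N} - {0..k}. fps_nth (h m) d * forest_weight h (a + d) (B - {m}) = 0"
            using cardm[OF m] True by (auto simp: forest_weight_def k_def)
        qed auto
        \<comment> \<open>The factor \<open>a + d\<close> of the smaller weight is split. Its part
          \<open>d\<close> is absorbed into \<open>fps_XD (h m)\<close>, so both parts become Cauchy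
          products at degree \<open>k\<close>.\<close>
        also have "\<dots> = (\<Sum>d=0..k. of_nat (fact (M - 2)) *
            (of_nat a * (fps_nth (h m) d * fps_nth (Q m) (k - d))
              + fps_nth (fps_XD (h m)) d * fps_nth (Q m) (k - d)))"
        proof (rule sum.cong)
          fix d assume "d \<in> {0..k}"
          then have d: "d \<le> k" "a + d \<le> M - 1" "M - 1 - (a + d) = k - d" "M - 1 - 1 = M - 2"
            using True by (auto simp: k_def)
          show "fps_nth (h m) d * forest_weight h (a + d) (B - {m}) =
            of_nat (fact (M - 2)) *
            (of_nat a * (fps_nth (h m) d * fps_nth (Q m) (k - d))
              + fps_nth (fps_XD (h m)) d * fps_nth (Q m) (k - d))"
            unfolding forest_weight_def cardm(1)[OF m] d(3,4) Q_def[symmetric]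
            using d(2) cardm(2)[OF m] by (simp add: algebra_simps)
        qed simp
        also have "\<dots> = of_nat (fact (M - 2)) *
            (of_nat a * fps_nth (h m * Q m) k + fps_nth (fps_XD (h m) * Q m) k)"
          by (simp only: fps_mult_nth sum_distrib_left sum.distrib distrib_left)
        finally show ?thesis by (simp only: hQ[OF m])
      qed
      have XD: "(\<Sum>m\<in>B. fps_nth (fps_XD (h m) * Q m) k) = of_nat k * fps_nth P k"
      proof -
        have "(\<Sum>m\<in>B. fps_XD (h m) * Q m) = fps_XD P"
          by (simp add: fps_XD_def P_def Q_def fps_deriv_prod sum_distrib_left mult.assoc)
        then show ?thesis by (metis fps_XD_nth fps_sum_nth)
      qed
      \<comment> \<open>After summation over \<open>m\<close> the total factor is
        \<open>(M - 2)!\<close> times \<open>M a + k\<close>; these identities turn it into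
        \<open>(a + 1) (M - 1)!\<close>, the prefactor of the left-hand side.\<close>
      have "M * a + k = Suc a * (M - 1)" "fact (M - 1) = (M - 1) * (fact (M - 2) :: nat)"
      proof -
        obtain j where "M = Suc (Suc j)" using 3 M_def
          by (metis add_2_eq_Suc le_iff_add)
        with True show "M * a + k = Suc a * (M - 1)"
            "fact (M - 1) = (M - 1) * (fact (M - 2) :: nat)"
          by (auto simp: k_def algebra_simps)
      qed
      then have num: "fact (M - 2) * (M * a + k) = Suc a * (fact (M - 1) :: nat)"
        by (simp only: mult_ac)
      have "(\<Sum>m\<in>B. \<Sum>d\<le>N. fps_nth (h m) d * forest_weight h (a + d) (B - {m}))
        = of_nat (fact (M - 2)) * (of_nat M * of_nat a * fps_nth P k + of_nat k * fps_nth P k)"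
        by (simp add: inner sum.distrib XD[symmetric] M_def mult.assoc flip: sum_distrib_left)
      also have "\<dots> = of_nat (fact (M - 2) * (M * a + k)) * fps_nth P k"
        by (simp add: algebra_simps)
      also have "\<dots> = forest_weight h (Suc a) B"
      proof -
        have "k = card B - Suc a" "B \<noteq> {}" using 3 by (auto simp: k_def M_def)
        then show ?thesis
          unfolding num using True by (simp add: forest_weight_def M_def P_def)
      qed
      finally show ?thesis ..
    qed
  qed
qed

text \<open>A set with a marked element is the same as an element together with a subset of the
  rest. This moves the root picked by \<open>forest_weight_Suc\<close> outside the sum over
  subsets.\<close>

lemma sum_Pow_pick_swap:
  fixes f :: "'i \<Rightarrow> 'i set \<Rightarrow> 'a::comm_monoid_add"
  assumes "finite B"
  shows "(\<Sum>S\<in>Pow B. \<Sum>m\<in>S. f m (S - {m})) = (\<Sum>m\<in>B. \<Sum>T\<in>Pow (B - {m}). f m T)"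
proof -
  have fin: "finite (Pow B)" "\<forall>S\<in>Pow B. finite S" "\<forall>m\<in>B. finite (Pow (B - {m}))"
    using assms by (auto intro: finite_subset)
  have "(\<Sum>S\<in>Pow B. \<Sum>m\<in>S. f m (S - {m})) = (\<Sum>(S, m)\<in>(SIGMA S:Pow B. S). f m (S - {m}))"
    using fin by (simp add: sum.Sigma)
  also have "\<dots> = (\<Sum>(m, T)\<in>Sigma B (\<lambda>m. Pow (B - {m})). f m T)"
    by (rule sum.reindex_bij_witness[where i = "\<lambda>(m, T). (insert m T, m)"
          and j = "\<lambda>(S, m). (m, S - {m})"]) auto
  also have "\<dots> = (\<Sum>m\<in>B. \<Sum>T\<in>Pow (B - {m}). f m T)"
    using assms fin by (simp add: sum.Sigma)
  finally show ?thesis .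
qed

text \<open>Splitting \<open>a + b\<close> ordered roots into the first \<open>a\<close> and the
  last \<open>b\<close> splits the forest. In the proof the first factor is expanded by
  \<open>forest_weight_Suc\<close>, the induction hypothesis evaluates the convolution over
  \<open>B - {m}\<close>, and the same recursion read backwards reassembles the result.\<close>

lemma forest_weight_convolution:
  fixes h :: "'i \<Rightarrow> 'a::comm_ring_1 fps"
  assumes "finite B"
  shows "(\<Sum>S\<in>Pow B. forest_weight h a S * forest_weight h b (B - S)) = forest_weight h (a + b) B"
  using assms
proof (induction "card B" arbitrary: a b B rule: less_induct)
  case less
  show ?case
  proof (cases a)
    case 0
    have "(\<Sum>S\<in>Pow B. forest_weight h 0 S * forest_weight h b (B - S))
        = (\<Sum>S\<in>{{}}. forest_weight h 0 S * forest_weight h b (B - S))"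
      using less.prems by (intro sum.mono_neutral_right) (auto simp: forest_weight_0)
    with 0 show ?thesis by (simp add: forest_weight_0)
  next
    case (Suc a')
    \<comment> \<open>This bounds the size of every subset, so the range of \<open>d\<close> does
      not depend on \<open>S\<close> and the sums can be exchanged.\<close>
    define N where "N = card B"
    define f where "f m T = (\<Sum>d\<le>N. fps_nth (h m) d * forest_weight h (a' + d) T) *
      forest_weight h b (B - {m} - T)" for m T
    have "(\<Sum>S\<in>Pow B. forest_weight h a S * forest_weight h b (B - S)) =
        (\<Sum>S\<in>Pow B. \<Sum>m\<in>S. f m (S - {m}))"
    proof (rule sum.cong)
      fix S assume S: "S \<in> Pow B"
      then have "finite S" "card S \<le> N"
        using less.prems by (auto simp: N_def intro: finite_subset card_mono)
      moreover have "B - {m} - (S - {m}) = B - S" if "m \<in> S" for m using that by auto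
      ultimately show "forest_weight h a S * forest_weight h b (B - S) = (\<Sum>m\<in>S. f m (S - {m}))"
        unfolding Suc forest_weight_Suc[OF \<open>finite S\<close> \<open>card S \<le> N\<close>] sum_distrib_right[of _ S] f_def
        by (intro sum.cong) auto
    qed simp
    also have "\<dots> = (\<Sum>m\<in>B. \<Sum>T\<in>Pow (B - {m}). f m T)"
      by (rule sum_Pow_pick_swap[OF less.prems])
    also have "\<dots> = (\<Sum>m\<in>B. \<Sum>d\<le>N. fps_nth (h m) d * forest_weight h (a' + b + d) (B - {m}))"
    proof (rule sum.cong)
      fix m assume m: "m \<in> B"
      have "card (B - {m}) < card B" using less.prems m by (rule card_Diff1_less)
      note IH = less.hyps[OF this, of "a' + d" b for d]
      have "(\<Sum>T\<in>Pow (B - {m}). f m T) = (\<Sum>d\<le>N. fps_nth (h m) d *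
        (\<Sum>T\<in>Pow (B - {m}). forest_weight h (a' + d) T * forest_weight h b (B - {m} - T)))"
        unfolding f_def sum_distrib_left sum_distrib_right
        by (subst sum.swap) (simp add: mult.assoc)
      also have "\<dots> = (\<Sum>d\<le>N. fps_nth (h m) d * forest_weight h (a' + b + d) (B - {m}))"
      proof (rule sum.cong)
        show "fps_nth (h m) d *
            (\<Sum>T\<in>Pow (B - {m}). forest_weight h (a' + d) T * forest_weight h b (B - {m} - T))
          = fps_nth (h m) d * forest_weight h (a' + b + d) (B - {m})" for d
          using IH[of d] less.prems by (simp add: add.assoc add.commute[of d])
      qed simp
      finally show "(\<Sum>T\<in>Pow (B - {m}). f m T) = \<dots>" .
    qed simp
    also have "\<dots> = forest_weight h (a + b) B"
      using forest_weight_Suc[of B N h "a' + b"] less.prems by (simp add: Suc N_def)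
    finally show ?thesis .
  qed
qed

lemma Diff_Diff_commute: "A - B - C = A - C - (B :: 'b set)"
  by auto

text \<open>By symmetry \<open>p\<close> is equally likely to lie in each of the
  \<open>a + 1\<close> trees. The proof is by induction on \<open>a\<close>: if \<open>V\<close> is
  the part of the convolution with \<open>p\<close> in \<open>S\<close>, the remaining part in the
  step equals \<open>(a + 1) V\<close>, which gives \<open>(a + 2) V\<close> in total.\<close>

lemma forest_weight_pointed:
  fixes h :: "'i \<Rightarrow> 'a::comm_ring_1 fps"
  assumes "finite B" "p \<in> B"
  shows "forest_weight h (Suc a) B =
    of_nat (Suc a) * (\<Sum>S\<in>{S\<in>Pow B. p \<in> S}. forest_weight h 1 S * forest_weight h a (B - S))"
  using assms
proof (induction a arbitrary: B)
  case 0
  have "(\<Sum>S\<in>{S\<in>Pow B. p \<in> S}. forest_weight h 1 S * forest_weight h 0 (B - S)) =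
        (\<Sum>S\<in>{B}. forest_weight h 1 S * forest_weight h 0 (B - S))"
    using 0 by (intro sum.mono_neutral_right) (auto simp: forest_weight_0)
  then show ?case by (simp add: forest_weight_0)
next
  case (Suc a)
  let ?w = "forest_weight h"
  let ?In = "{S\<in>Pow B. p \<in> S}" and ?Out = "{S\<in>Pow B. p \<notin> S}"
  define V where "V = (\<Sum>S\<in>?In. ?w 1 S * ?w (Suc a) (B - S))"
  have "?w (Suc (Suc a)) B = (\<Sum>S\<in>Pow B. ?w 1 S * ?w (Suc a) (B - S))"
    using forest_weight_convolution[OF Suc.prems(1), of h 1 "Suc a"] by simp
  also have "\<dots> = V + (\<Sum>S\<in>?Out. ?w 1 S * ?w (Suc a) (B - S))"
  proof -
    have *: "Pow B = ?In \<union> ?Out" by auto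
    show ?thesis unfolding V_def
      by (subst *, rule sum.union_disjoint) (use Suc.prems in auto)
  qed
  also have "(\<Sum>S\<in>?Out. ?w 1 S * ?w (Suc a) (B - S)) =
      (\<Sum>S\<in>?Out. \<Sum>T\<in>{T\<in>Pow (B - S). p \<in> T}.
        of_nat (Suc a) * (?w 1 S * (?w 1 T * ?w a (B - S - T))))"
  proof (rule sum.cong)
    fix S assume "S \<in> ?Out"
    then have "finite (B - S)" "p \<in> B - S" using Suc.prems by auto
    from Suc.IH[OF this]
    show "?w 1 S * ?w (Suc a) (B - S) = (\<Sum>T\<in>{T\<in>Pow (B - S). p \<in> T}.
        of_nat (Suc a) * (?w 1 S * (?w 1 T * ?w a (B - S - T))))"
      by (simp add: sum_distrib_left mult_ac)
  qed simp
  also have "\<dots> = (\<Sum>(S, T)\<in>(SIGMA S:?Out. {T\<in>Pow (B - S). p \<in> T}).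
        of_nat (Suc a) * (?w 1 S * (?w 1 T * ?w a (B - S - T))))"
    using Suc.prems by (subst sum.Sigma) auto
  \<comment> \<open>Once \<open>T\<close> is chosen first and contains \<open>p\<close>, the set
    \<open>S\<close> runs through all subsets of \<open>B - T\<close>, so the inner sum is a full
    convolution.\<close>
  also have "\<dots> = (\<Sum>(T, S)\<in>(SIGMA T:?In. Pow (B - T)).
        of_nat (Suc a) * (?w 1 T * (?w 1 S * ?w a (B - T - S))))"
    by (rule sum.reindex_bij_witness[where i = prod.swap and j = prod.swap])
       (auto simp: mult.left_commute Diff_Diff_commute)
  also have "\<dots> = (\<Sum>T\<in>?In. of_nat (Suc a) * (?w 1 T * (\<Sum>S\<in>Pow (B - T). ?w 1 S * ?w a (B - T - S))))"
    using Suc.prems by (subst sum.Sigma[symmetric]) (auto simp: sum_distrib_left)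
  also have "\<dots> = of_nat (Suc a) * V"
    using Suc.prems by (simp add: forest_weight_convolution V_def sum_distrib_left)
  finally show ?case by (simp only: V_def of_nat_Suc distrib_right mult_1)
qed

section \<open>Sums over set partitions\<close>

text \<open>Generalizes \<open>Spart\<close> from \<open>{1..M}\<close> to any ground set, which
  allows induction by removal of the first block.\<close>

definition ordered_partitions :: "nat set \<Rightarrow> nat \<Rightarrow> nat set list set" where
  "ordered_partitions B a = {ss. length ss = a
      \<and> (\<forall>i<a. ss ! i \<noteq> {})
      \<and> (\<forall>i<a. \<forall>j<a. i \<noteq> j \<longrightarrow> ss ! i \<inter> ss ! j = {})
      \<and> \<Union>(set ss) = B
      \<and> (\<forall>i<a. \<forall>j<a. i < j \<longrightarrow> Min (ss ! i) < Min (ss ! j))}"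

lemma finite_ordered_partitions:
  assumes "finite B"
  shows "finite (ordered_partitions B a)"
proof (rule finite_subset)
  show "ordered_partitions B a \<subseteq> {ss. set ss \<subseteq> Pow B \<and> length ss = a}"
    by (auto simp: ordered_partitions_def)
  show "finite {ss. set ss \<subseteq> Pow B \<and> length ss = a}"
    using assms by (intro finite_lists_length_eq) simp
qed

lemma ordered_partitions_0: "ordered_partitions B 0 = (if B = {} then {[]} else {})"
  by (auto simp: ordered_partitions_def)

lemma ordered_partitions_empty_Suc: "ordered_partitions {} (Suc a) = {}"
proof -
  have False if "ss \<in> ordered_partitions {} (Suc a)" for ss
  proof -
    from that have "ss ! 0 \<in> set ss" "ss ! 0 \<noteq> {}" "\<Union>(set ss) = {}"
      unfolding ordered_partitions_def by auto
    then show False by blast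
  qed
  then show ?thesis by blast
qed

text \<open>Blocks are listed by increasing minima, so the first block is exactly the one that
  contains \<open>Min B\<close>.\<close>

lemma Cons_in_ordered_partitions:
  assumes "finite B"
  shows "S # ss \<in> ordered_partitions B (Suc a) \<longleftrightarrow>
    S \<subseteq> B \<and> B \<noteq> {} \<and> Min B \<in> S \<and> ss \<in> ordered_partitions (B - S) a"
proof
  assume l: "S # ss \<in> ordered_partitions B (Suc a)"
  then have len: "length ss = a" and ne: "S \<noteq> {}" "\<And>i. i < a \<Longrightarrow> ss ! i \<noteq> {}"
    and disj: "\<And>i j. i < Suc a \<Longrightarrow> j < Suc a \<Longrightarrow> i \<noteq> j \<Longrightarrow> (S # ss) ! i \<inter> (S # ss) ! j = {}"
    and un: "S \<union> \<Union>(set ss) = B"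
    and mins: "\<And>i j. i < j \<Longrightarrow> j < Suc a \<Longrightarrow> Min ((S # ss) ! i) < Min ((S # ss) ! j)"
    unfolding ordered_partitions_def by (auto simp: nth_Cons split: nat.splits)
  have disj0: "S \<inter> ss ! i = {}" "Min S < Min (ss ! i)" if "i < a" for i
    using disj[of 0 "Suc i"] mins[of 0 "Suc i"] that by auto
  have disj1: "ss ! i \<inter> ss ! j = {}" if "i < a" "j < a" "i \<noteq> j" for i j
    using disj[of "Suc i" "Suc j"] that by auto
  have mins1: "Min (ss ! i) < Min (ss ! j)" if "i < j" "j < a" for i j
    using mins[of "Suc i" "Suc j"] that by auto
  have subset: "\<Union>(set ss) = B - S"
    using un disj0(1) len by (fastforce simp: in_set_conv_nth)
  have B: "B \<noteq> {}" "S \<subseteq> B" using ne un by auto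
  have finS: "finite S" using assms B finite_subset by blast
  \<comment> \<open>A point outside \<open>S\<close> lies in a later block, whose minimum exceeds
    \<open>Min S\<close>.\<close>
  have "Min B = Min S"
  proof (rule Min_eqI[OF assms])
    show "Min S \<in> B" using B(2) Min_in[OF finS ne(1)] by blast
    fix y assume "y \<in> B"
    show "Min S \<le> y"
    proof (cases "y \<in> S")
      case True then show ?thesis using finS by simp
    next
      case False
      then obtain i where i: "i < a" "y \<in> ss ! i"
        using \<open>y \<in> B\<close> subset len by (metis Diff_iff UnionE in_set_conv_nth)
      then have "ss ! i \<subseteq> B" using subset len nth_mem by blast
      then have "Min (ss ! i) \<le> y" using i assms finite_subset by (metis Min_le)
      then show ?thesis using disj0(2)[OF i(1)] by simp
    qed
  qed
  then have "Min B \<in> S" using ne finS by simp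
  moreover have "ss \<in> ordered_partitions (B - S) a"
    using len ne disj1 mins1 subset by (auto simp: ordered_partitions_def)
  ultimately show "S \<subseteq> B \<and> B \<noteq> {} \<and> Min B \<in> S \<and> ss \<in> ordered_partitions (B - S) a"
    using B by blast
next
  assume r: "S \<subseteq> B \<and> B \<noteq> {} \<and> Min B \<in> S \<and> ss \<in> ordered_partitions (B - S) a"
  then have len: "length ss = a" and ne: "\<And>i. i < a \<Longrightarrow> ss ! i \<noteq> {}"
    and disj: "\<And>i j. i < a \<Longrightarrow> j < a \<Longrightarrow> i \<noteq> j \<Longrightarrow> ss ! i \<inter> ss ! j = {}"
    and un: "\<Union>(set ss) = B - S"
    and mins: "\<And>i j. i < j \<Longrightarrow> j < a \<Longrightarrow> Min (ss ! i) < Min (ss ! j)"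
    unfolding ordered_partitions_def by auto
  have sub: "ss ! i \<subseteq> B - S" if "i < a" for i
    using un len that nth_mem by blast
  have "Min S = Min B"
  proof (rule Min_eqI)
    show "finite S" using r assms finite_subset by blast
    show "Min B \<le> y" if "y \<in> S" for y using r assms that by auto
  qed (use r in blast)
  moreover have "Min B < Min (ss ! i)" if i: "i < a" for i
  proof -
    have "Min (ss ! i) \<in> ss ! i"
      using sub[OF i] ne[OF i] assms by (meson Min_in finite_Diff finite_subset)
    then have "Min (ss ! i) \<in> B" "Min (ss ! i) \<noteq> Min B" using sub[OF i] r by auto
    then show ?thesis using assms by (metis Min_le order_le_imp_less_or_eq)
  qed
  moreover have "S \<noteq> {}" "S \<union> \<Union>(set ss) = B" using r un by auto
  moreover have "S \<inter> ss ! i = {}" if "i < a" for i using sub[OF that] by auto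
  ultimately show "S # ss \<in> ordered_partitions B (Suc a)"
    using len ne disj mins
    by (auto simp: ordered_partitions_def nth_Cons Int_commute split: nat.splits)
qed

lemma sum_ordered_partitions_Suc:
  fixes f :: "nat set \<Rightarrow> 'a::comm_semiring_1"
  assumes "finite B" "B \<noteq> {}"
  shows "(\<Sum>ss\<in>ordered_partitions B (Suc a). \<Prod>i<Suc a. f (ss ! i)) =
    (\<Sum>S\<in>{S\<in>Pow B. Min B \<in> S}. f S * (\<Sum>ss\<in>ordered_partitions (B - S) a. \<Prod>i<a. f (ss ! i)))"
proof -
  have "(\<Sum>ss\<in>ordered_partitions B (Suc a). \<Prod>i<Suc a. f (ss ! i)) =
      (\<Sum>(S, ss)\<in>(SIGMA S:{S\<in>Pow B. Min B \<in> S}. ordered_partitions (B - S) a).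
        f S * (\<Prod>i<a. f (ss ! i)))"
  proof (rule sum.reindex_bij_witness[where i = "\<lambda>(S, ss). S # ss" and j = "\<lambda>l. (hd l, tl l)"],
      goal_cases)
    case (1 ss)
    then show ?case by (cases ss) (auto simp: ordered_partitions_def)
  next
    case (2 ss)
    then show ?case using Cons_in_ordered_partitions[OF assms(1)]
      by (cases ss) (auto simp: ordered_partitions_def)
  next
    case (4 p)
    then show ?case using Cons_in_ordered_partitions[OF assms(1)] assms(2) by auto
  next
    case (5 ss)
    then obtain S ts where "ss = S # ts" by (cases ss) (auto simp: ordered_partitions_def)
    then show ?case by (simp add: prod.lessThan_Suc_shift del: prod.lessThan_Suc)
  qed auto
  also have "\<dots> = (\<Sum>S\<in>{S\<in>Pow B. Min B \<in> S}. f S *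
      (\<Sum>ss\<in>ordered_partitions (B - S) a. \<Prod>i<a. f (ss ! i)))"
    using assms by (subst sum.Sigma[symmetric]) (auto simp: finite_ordered_partitions sum_distrib_left)
  finally show ?thesis .
qed

text \<open>Splitting off the block of \<open>Min B\<close> gives the recursion of
  \<open>forest_weight_pointed\<close> with \<open>p = Min B\<close>. Its factors
  \<open>Suc a\<close> accumulate to \<open>fact a\<close>: a partition is listed in one order only,
  whereas \<open>forest_weight\<close> counts all orders of the trees.\<close>

lemma sum_ordered_partitions_forest_weight:
  fixes h :: "nat \<Rightarrow> 'a::comm_ring_1 fps"
  assumes "finite B"
  shows "of_nat (fact a) * (\<Sum>ss\<in>ordered_partitions B a. \<Prod>i<a. forest_weight h 1 (ss ! i))
    = forest_weight h a B"
  using assms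
proof (induction a arbitrary: B)
  case 0
  then show ?case by (simp add: ordered_partitions_0 forest_weight_0)
next
  case (Suc a)
  show ?case
  proof (cases "B = {}")
    case True
    then show ?thesis by (simp add: ordered_partitions_empty_Suc forest_weight_empty)
  next
    case False
    then have "Min B \<in> B" using Suc.prems by simp
    have "of_nat (fact (Suc a)) *
        (\<Sum>ss\<in>ordered_partitions B (Suc a). \<Prod>i<Suc a. forest_weight h 1 (ss ! i))
      = of_nat (Suc a) * (\<Sum>S\<in>{S\<in>Pow B. Min B \<in> S}. forest_weight h 1 S *
          (of_nat (fact a) * (\<Sum>ss\<in>ordered_partitions (B - S) a. \<Prod>i<a. forest_weight h 1 (ss ! i))))"
      unfolding sum_ordered_partitions_Suc[OF Suc.prems False]
      by (simp only: fact_Suc of_nat_mult of_nat_id sum_distrib_left mult_ac)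
    also have "\<dots> = forest_weight h (Suc a) B"
      using Suc forest_weight_pointed[OF Suc.prems \<open>Min B \<in> B\<close>, of h a] by simp
    finally show ?thesis .
  qed
qed

section \<open>Expansion of negative powers\<close>

text \<open>Forcing the value 0 outside \<open>I\<close> gives each exponent vector a single
  representative and keeps the set finite for finite \<open>I\<close>.\<close>

definition weak_compositions :: "'i set \<Rightarrow> nat \<Rightarrow> ('i \<Rightarrow> nat) set" where
  "weak_compositions I s = {\<nu>. (\<forall>i. i \<notin> I \<longrightarrow> \<nu> i = 0) \<and> sum \<nu> I = s}"

lemma finite_weak_compositions:
  assumes "finite I"
  shows "finite (weak_compositions I s)"
proof (rule finite_subset)
  show "weak_compositions I s \<subseteq> {\<nu>. \<forall>i. (i \<in> I \<longrightarrow> \<nu> i \<in> {..s}) \<and> (i \<notin> I \<longrightarrow> \<nu> i = 0)}"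
    using member_le_sum[OF _ _ assms] by (force simp: weak_compositions_def)
  show "finite {\<nu>. \<forall>i. (i \<in> I \<longrightarrow> \<nu> i \<in> {..s}) \<and> (i \<notin> I \<longrightarrow> \<nu> i = 0)}"
    using assms by (intro finite_set_of_finite_funs) auto
qed

lemma fps_divided_power_add:
  fixes a b :: "'a::field_char_0 fps"
  shows "fps_const (1 / fact s) * (a + b) ^ s =
    (\<Sum>k\<le>s. (fps_const (1 / fact k) * a ^ k) * (fps_const (1 / fact (s - k)) * b ^ (s - k)))"
proof -
  have "fps_const (1 / fact s) * (of_nat (s choose k) * a ^ k * b ^ (s - k)) =
     (fps_const (1 / fact k) * a ^ k) * (fps_const (1 / fact (s - k)) * b ^ (s - k))"
    if "k \<le> s" for k
  proof -
    have "fps_const (1 / fact s) * of_nat (s choose k) =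
          fps_const (1 / fact k) * (fps_const (1 / fact (s - k)) :: 'a fps)"
      using that by (simp add: fps_of_nat[symmetric] binomial_fact)
    then show ?thesis by (metis (no_types, lifting) mult.assoc mult.left_commute)
  qed
  then show ?thesis unfolding binomial_ring sum_distrib_left by (intro sum.cong) simp_all
qed

text \<open>The multinomial theorem for divided powers \<open>y^k / k!\<close>: all its coefficients
  are 1, so the binomial case \<open>fps_divided_power_add\<close> iterates directly. The
  denominators become the factorials of the \<mu>'s in \<open>F\<close>.\<close>

lemma fps_divided_power_sum:
  fixes y :: "'i \<Rightarrow> 'a::field_char_0 fps"
  assumes "finite I"
  shows "fps_const (1 / fact s) * (\<Sum>i\<in>I. y i) ^ s =
    (\<Sum>\<nu>\<in>weak_compositions I s. \<Prod>i\<in>I. fps_const (1 / fact (\<nu> i)) * y i ^ \<nu> i)"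
  using assms
proof (induction I arbitrary: s rule: finite_induct)
  case empty
  have "weak_compositions {} s = (if s = 0 then {\<lambda>_::'i. 0} else {})"
    by (auto simp: weak_compositions_def)
  then show ?case by simp
next
  case (insert j I)
  let ?t = "\<lambda>\<nu> i. fps_const (1 / fact (\<nu> i)) * y i ^ \<nu> i"
  have "fps_const (1 / fact s) * (\<Sum>i\<in>insert j I. y i) ^ s =
    (\<Sum>k\<le>s. (fps_const (1 / fact k) * y j ^ k) * (\<Sum>\<nu>\<in>weak_compositions I (s - k). \<Prod>i\<in>I. ?t \<nu> i))"
    using insert by (simp add: fps_divided_power_add)
  also have "\<dots> = (\<Sum>(k, \<nu>)\<in>(SIGMA k:{..s}. weak_compositions I (s - k)).
      (fps_const (1 / fact k) * y j ^ k) * (\<Prod>i\<in>I. ?t \<nu> i))"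
    using insert by (simp add: sum_distrib_left sum.Sigma finite_weak_compositions)
  also have "\<dots> = (\<Sum>\<nu>\<in>weak_compositions (insert j I) s. \<Prod>i\<in>insert j I. ?t \<nu> i)"
  proof (rule sum.reindex_bij_witness[where i = "\<lambda>\<nu>. (\<nu> j, \<nu>(j := 0))"
        and j = "\<lambda>(k, \<nu>). \<nu>(j := k)"], goal_cases)
    case (1 p)
    then show ?case using insert by (auto simp: weak_compositions_def)
  next
    case (2 p)
    have upd: "sum (\<nu>(j := k)) I = sum \<nu> I" for \<nu> :: "'i \<Rightarrow> nat" and k
      using insert by (intro sum.cong) auto
    from 2 show ?case using insert upd by (auto simp: weak_compositions_def)
  next
    case (3 \<nu>)
    then show ?case by auto
  next
    case (4 \<nu>)
    have "sum (\<nu>(j := 0)) I = sum \<nu> I"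
      using insert by (intro sum.cong) auto
    with 4 insert.hyps show ?case by (auto simp: weak_compositions_def simp del: fun_upd_apply) simp
  next
    case (5 p)
    obtain k \<nu> where p: "p = (k, \<nu>)" by (cases p)
    have "(\<Prod>i\<in>I. ?t (\<nu>(j := k)) i) = (\<Prod>i\<in>I. ?t \<nu> i)"
      using insert by (intro prod.cong) auto
    then show ?case using insert by (simp add: p)
  qed
  finally show ?case .
qed

text \<open>The degree in \<open>w\<close> of the product of the monomials
  \<open>(c i * w^(i - 1))^(\<nu> i)\<close>.\<close>

definition weight :: "(nat \<Rightarrow> nat) \<Rightarrow> nat set \<Rightarrow> nat" where
  "weight \<nu> I = (\<Sum>i\<in>I. (i - 1) * \<nu> i)"

lemma fps_nth_divided_power_monomial_sum:
  fixes c :: "nat \<Rightarrow> 'a::field_char_0"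
  assumes "finite I"
  shows "fps_nth ((\<Sum>i\<in>I. fps_const (c i) * fps_X ^ (i - 1)) ^ s) n / fact s =
    (\<Sum>\<nu>\<in>{\<nu>\<in>weak_compositions I s. weight \<nu> I = n}. \<Prod>i\<in>I. c i ^ \<nu> i / fact (\<nu> i))"
proof -
  have mono: "(\<Prod>i\<in>I. fps_const (1 / fact (\<nu> i)) * (fps_const (c i) * fps_X ^ (i - 1)) ^ \<nu> i) =
      fps_const (\<Prod>i\<in>I. c i ^ \<nu> i / fact (\<nu> i)) * fps_X ^ weight \<nu> I" for \<nu>
    unfolding weight_def using assms
  proof (induction I rule: finite_induct)
    case (insert j J)
    have *: "fps_const (1 / fact (\<nu> j)) * (fps_const (c j) * fps_X ^ (j - 1)) ^ \<nu> j =
      fps_const (c j ^ \<nu> j / fact (\<nu> j)) * fps_X ^ ((j - 1) * \<nu> j)"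
      by (simp add: power_mult_distrib power_mult mult.assoc[symmetric])
    have **: "fps_const a * fps_X ^ p * (fps_const b * fps_X ^ q) =
        (fps_const (a * b) * fps_X ^ (p + q) :: 'a fps)" for a b p q
      unfolding power_add fps_const_mult[symmetric] by (simp only: mult_ac)
    show ?case
      unfolding prod.insert[OF insert.hyps] sum.insert[OF insert.hyps] insert.IH * ** ..
  qed simp
  have "fps_nth ((\<Sum>i\<in>I. fps_const (c i) * fps_X ^ (i - 1)) ^ s) n / fact s =
      fps_nth (fps_const (1 / fact s) * (\<Sum>i\<in>I. fps_const (c i) * fps_X ^ (i - 1)) ^ s) n"
    by simp
  also have "\<dots> = (\<Sum>\<nu>\<in>weak_compositions I s.
      (\<Prod>i\<in>I. c i ^ \<nu> i / fact (\<nu> i)) * (if n = weight \<nu> I then 1 else 0))"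
    unfolding fps_divided_power_sum[OF assms] fps_sum_nth mono by simp
  also have "\<dots> = (\<Sum>\<nu>\<in>{\<nu>\<in>weak_compositions I s. weight \<nu> I = n}. \<Prod>i\<in>I. c i ^ \<nu> i / fact (\<nu> i))"
    using assms by (intro sum.mono_neutral_cong_right) (auto simp: finite_weak_compositions)
  finally show ?thesis .
qed

text \<open>Used to replace a series by a polynomial that agrees with it up to degree
  \<open>r\<close>.\<close>

lemma fps_power_nth_cong:
  fixes f g :: "'a::comm_ring_1 fps"
  assumes "\<And>n. n \<le> r \<Longrightarrow> fps_nth f n = fps_nth g n" "n \<le> r"
  shows "fps_nth (f ^ s) n = fps_nth (g ^ s) n"
  using assms(2)
proof (induction s arbitrary: n)
  case (Suc s)
  then show ?case by (auto simp: fps_mult_nth assms(1) intro!: sum.cong)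
qed simp

text \<open>Produces the factorial \<open>(r + s)!\<close> of \<open>F\<close> from the binomial
  series with exponent \<open>-(r + 1)\<close>.\<close>

lemma gchoose_minus_Suc:
  "(- of_nat (Suc r) :: 'a::field_char_0) gchoose s = (-1) ^ s * fact (r + s) / (fact r * fact s)"
proof -
  have "(- of_nat (Suc r) :: 'a) gchoose s = (-1) ^ s * (of_nat (r + s) gchoose s)"
    by (subst gbinomial_minus) simp
  also have "(of_nat (r + s) :: 'a) gchoose s = fact (r + s) / (fact r * fact s)"
    unfolding binomial_gbinomial[symmetric] by (simp add: binomial_fact mult.commute)
  finally show ?thesis by simp
qed

lemma fps_nth_inverse_power_Suc:
  fixes u :: "'a::field_char_0 fps"
  assumes "b \<noteq> 0" "fps_nth u 0 = 0"
  shows "fact r * fps_nth (inverse (fps_const b + u) ^ Suc r) n =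
    (\<Sum>s\<le>n. (-1) ^ s * fact (r + s) / b ^ (r + 1 + s) * (fps_nth (u ^ s) n / fact s))"
proof -
  define v where "v = fps_const (1 / b) * u"
  have v0: "fps_nth v 0 = 0" using assms by (simp add: v_def)
  \<comment> \<open>After \<open>b\<close> is factored out, \<open>1 + v\<close> is a composition
    with \<open>1 + fps_X\<close>, so the negative power can be taken before substitution, where it
    is a binomial series.\<close>
  have "fps_const b + u = fps_const b * ((1 + fps_X) oo v)"
    using assms v0 by (simp add: fps_compose_add_distrib v_def distrib_left mult.assoc[symmetric])
  then have "inverse (fps_const b + u) ^ Suc r = fps_const (1 / b ^ Suc r) * inverse ((1 + fps_X) oo v) ^ Suc r"
    using assms by (simp add: fps_inverse_mult power_mult_distrib fps_const_inverse inverse_eq_divide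
        power_one_over del: power_Suc)
  also have "inverse ((1 + fps_X) oo v) ^ Suc r = inverse ((1 + fps_X) ^ Suc r) oo v"
  proof -
    have "inverse ((1 + fps_X) oo v) ^ Suc r = (inverse (1 + fps_X) oo v) ^ Suc r"
      by (subst fps_inverse_compose[OF v0]) simp_all
    also have "\<dots> = inverse ((1 + fps_X) ^ Suc r) oo v"
      unfolding fps_compose_power[OF v0] fps_inverse_power ..
    finally show ?thesis .
  qed
  also have "\<dots> = fps_binomial (- of_nat (Suc r)) oo v"
    by (subst fps_binomial_minus_of_nat) simp
  finally have "fps_nth (inverse (fps_const b + u) ^ Suc r) n =
     1 / b ^ Suc r * (\<Sum>s\<le>n. ((- of_nat (Suc r)) gchoose s) * (fps_nth (u ^ s) n / b ^ s))"
    by (simp add: fps_compose_nth v_def power_mult_distrib atMost_atLeast0 power_one_over del: power_Suc of_nat_Suc)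
  then show ?thesis
    unfolding gchoose_minus_Suc
    by (simp add: sum_distrib_left power_add mult_ac del: of_nat_Suc)
qed

text \<open>Indexes the finitely many terms of \<open>F\<close> that can be nonzero: \<nu> is \<mu>
  without its first entry, and a weight above \<open>K\<close> will make the lower index of the
  binomial coefficient negative.\<close>

definition bounded_weight :: "nat set \<Rightarrow> nat \<Rightarrow> (nat \<Rightarrow> nat) set" where
  "bounded_weight I K = {\<nu>. (\<forall>i. i \<notin> I \<longrightarrow> \<nu> i = 0) \<and> weight \<nu> I \<le> K}"

lemma sum_le_weight:
  assumes "I \<subseteq> {2..}"
  shows "sum \<nu> I \<le> weight \<nu> I"
  unfolding weight_def
proof (rule sum_mono)
  fix i assume "i \<in> I"
  then have "i - 1 \<ge> 1" using assms by auto
  then show "\<nu> i \<le> (i - 1) * \<nu> i" by (metis mult_le_mono1 mult_1)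
qed

lemma finite_bounded_weight:
  assumes "finite I" "I \<subseteq> {2..}"
  shows "finite (bounded_weight I K)"
proof (rule finite_subset)
  show "bounded_weight I K \<subseteq> (\<Union>s\<le>K. weak_compositions I s)"
  proof
    fix \<nu> assume "\<nu> \<in> bounded_weight I K"
    moreover from this have "sum \<nu> I \<le> K"
      using sum_le_weight[OF assms(2), of \<nu>] by (simp add: bounded_weight_def)
    ultimately show "\<nu> \<in> (\<Union>s\<le>K. weak_compositions I s)"
      by (simp add: bounded_weight_def weak_compositions_def)
  qed
  show "finite (\<Union>s\<le>K. weak_compositions I s)"
    using assms finite_weak_compositions by blast
qed

text \<open>The factor of \<open>Fterm\<close> that comes from the negative power. Its sign is that
  of \<open>sum \<nu> I\<close>; since \<mu> at 1 equals \<open>r - sum \<nu> I\<close>, it differs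
  from the sign in \<open>Fterm\<close> by \<open>(-1)^r\<close>.\<close>

definition inverse_power_term :: "(nat \<Rightarrow> complex) \<Rightarrow> nat \<Rightarrow> (nat \<Rightarrow> nat) \<Rightarrow> nat set \<Rightarrow> complex" where
  "inverse_power_term c r \<nu> I = (-1) ^ sum \<nu> I * fact (r + sum \<nu> I) / c 1 ^ (r + 1 + sum \<nu> I)
     * (\<Prod>i\<in>I. c i ^ \<nu> i / fact (\<nu> i))"

lemma fps_nth_inverse_power_expansion:
  assumes "c 1 \<noteq> 0" "n \<le> K" "K \<le> r"
  shows "fact r * fps_nth (inverse (Abs_fps (\<lambda>i. c (Suc i))) ^ Suc r) n =
    (\<Sum>\<nu>\<in>{\<nu>\<in>bounded_weight {2..Suc r} K. weight \<nu> {2..Suc r} = n}. inverse_power_term c r \<nu> {2..Suc r})"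
proof -
  define I where "I = {2..Suc r}"
  have I: "finite I" "I \<subseteq> {2..}" by (auto simp: I_def)
  define u where "u = Abs_fps (\<lambda>i. if i = 0 then 0 else c (Suc i))"
  define A where "A = {\<nu>\<in>bounded_weight I K. weight \<nu> I = n}"
  have "Abs_fps (\<lambda>i. c (Suc i)) = fps_const (c 1) + u"
    by (rule fps_ext) (simp add: u_def)
  moreover have "fps_nth u 0 = 0" by (simp add: u_def)
  ultimately have "fact r * fps_nth (inverse (Abs_fps (\<lambda>i. c (Suc i))) ^ Suc r) n =
      (\<Sum>s\<le>n. (-1) ^ s * fact (r + s) / c 1 ^ (r + 1 + s) * (fps_nth (u ^ s) n / fact s))"
    using fps_nth_inverse_power_Suc[OF assms(1), of u r n] by simp
  also have "\<dots> = (\<Sum>s\<le>n. \<Sum>\<nu>\<in>{\<nu>\<in>A. sum \<nu> I = s}. inverse_power_term c r \<nu> I)"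
  proof (rule sum.cong)
    fix s
    \<comment> \<open>Only coefficients up to degree \<open>n\<close>, at most \<open>r\<close>, are
      read off, so the indices in \<open>{2..Suc r}\<close> suffice.\<close>
    have trunc: "fps_nth u m = fps_nth (\<Sum>i\<in>I. fps_const (c i) * fps_X ^ (i - 1)) m" if "m \<le> r" for m
    proof -
      have "fps_nth (\<Sum>i\<in>I. fps_const (c i) * fps_X ^ (i - 1)) m =
          (\<Sum>i\<in>I. if i = Suc m then c (Suc m) else 0)"
        unfolding fps_sum_nth by (rule sum.cong) (auto simp: I_def)
      also have "\<dots> = fps_nth u m"
        using that I(1) by (auto simp: u_def I_def)
      finally show ?thesis ..
    qed
    have "fps_nth (u ^ s) n / fact s =
        (\<Sum>\<nu>\<in>{\<nu>\<in>weak_compositions I s. weight \<nu> I = n}. \<Prod>i\<in>I. c i ^ \<nu> i / fact (\<nu> i))"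
      using fps_nth_divided_power_monomial_sum[OF I(1)] fps_power_nth_cong[OF trunc] assms by simp
    also have "{\<nu>\<in>weak_compositions I s. weight \<nu> I = n} = {\<nu>\<in>A. sum \<nu> I = s}"
      using assms by (auto simp: A_def weak_compositions_def bounded_weight_def)
    finally show "(-1) ^ s * fact (r + s) / c 1 ^ (r + 1 + s) * (fps_nth (u ^ s) n / fact s) =
        (\<Sum>\<nu>\<in>{\<nu>\<in>A. sum \<nu> I = s}. inverse_power_term c r \<nu> I)"
      by (simp only: sum_distrib_left) (rule sum.cong, auto simp: inverse_power_term_def)
  qed simp
  also have "\<dots> = (\<Sum>\<nu>\<in>A. inverse_power_term c r \<nu> I)"
    using sum_le_weight[OF I(2)] finite_bounded_weight[OF I] by (intro sum.group) (auto simp: A_def)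
  finally show ?thesis unfolding A_def I_def .
qed

section \<open>Coefficient formula for F\<close>

text \<open>A point of \<open>L\<close> fixes one logarithm \<open>l\<close> for all exponents, so
  the exponent laws reduce to those of \<open>exp\<close>.\<close>

lemma Lpow_eq_exp:
  obtains l where "\<And>\<gamma>. Lpow \<alpha> \<gamma> = exp (\<gamma> * l)"
proof -
  obtain r \<theta> n where \<alpha>: "\<alpha> = (r, \<theta>, n)" by (cases \<alpha>)
  have "Lpow \<alpha> \<gamma> = exp (\<gamma> * (of_real (ln r) + \<i> * of_real \<theta> + 2 * of_real pi * \<i> * of_int n))" for \<gamma>
    by (simp add: Lpow_def \<alpha> algebra_simps)
  then show thesis using that by blast
qed

lemma Lpow_sum: "finite B \<Longrightarrow> Lpow \<alpha> (\<Sum>m\<in>B. x m) = (\<Prod>m\<in>B. Lpow \<alpha> (x m))"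
  by (rule Lpow_eq_exp[of \<alpha>]) (simp add: sum_distrib_right exp_sum)

lemma Lpow_uminus_of_nat: "Lpow \<alpha> (- of_nat k) = Lpow \<alpha> (-1) ^ k"
  by (rule Lpow_eq_exp[of \<alpha>]) (simp add: exp_of_nat_mult[symmetric])

text \<open>The power series of \<open>(\<alpha> + w)\<^sup>x / \<alpha>\<^sup>x\<close> in \<open>w\<close>.\<close>
definition binomial_series :: "Lpt \<Rightarrow> complex \<Rightarrow> complex fps" where
  "binomial_series \<alpha> x = fps_binomial x oo (fps_const (Lpow \<alpha> (-1)) * fps_X)"

lemma binomial_series_nth:
  "fps_nth (binomial_series \<alpha> x) k = (x gchoose k) * Lpow \<alpha> (- of_nat k)"
  by (simp add: binomial_series_def fps_compose_linear Lpow_uminus_of_nat)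

lemma binomial_series_sum:
  "finite B \<Longrightarrow> binomial_series \<alpha> (\<Sum>m\<in>B. x m) = (\<Prod>m\<in>B. binomial_series \<alpha> (x m))"
  by (induction B rule: finite_induct)
     (simp_all add: binomial_series_def fps_binomial_add_mult fps_compose_mult_distrib)

text \<open>Replaces the index set \<open>supp2 \<mu>\<close>, which varies with \<mu>, by a fixed
  interval; entry 1 is erased because it is determined by the others.\<close>

lemma supp2_weight:
  assumes "supp2 \<mu> \<subseteq> {2..Suc r}"
  shows "(\<Sum>i\<in>supp2 \<mu>. \<mu> i) = sum (\<mu>(1 := 0)) {2..Suc r}"
    and "(\<Sum>i\<in>supp2 \<mu>. (int i - 1) * int (\<mu> i)) = int (weight (\<mu>(1 := 0)) {2..Suc r})"
    and "(\<Prod>i\<in>supp2 \<mu>. c i ^ \<mu> i / of_nat (fact (\<mu> i)) :: complex) =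
         (\<Prod>i\<in>{2..Suc r}. c i ^ (\<mu>(1 := 0)) i / fact ((\<mu>(1 := 0)) i))"
proof -
  show "(\<Sum>i\<in>supp2 \<mu>. \<mu> i) = sum (\<mu>(1 := 0)) {2..Suc r}"
    using assms by (intro sum.mono_neutral_cong_left) (auto simp: supp2_def)
  show "(\<Sum>i\<in>supp2 \<mu>. (int i - 1) * int (\<mu> i)) = int (weight (\<mu>(1 := 0)) {2..Suc r})"
    unfolding weight_def of_nat_sum
    using assms by (intro sum.mono_neutral_cong_left) (auto simp: supp2_def of_nat_diff)
  show "(\<Prod>i\<in>supp2 \<mu>. c i ^ \<mu> i / of_nat (fact (\<mu> i)) :: complex) =
         (\<Prod>i\<in>{2..Suc r}. c i ^ (\<mu>(1 := 0)) i / fact ((\<mu>(1 := 0)) i))"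
    using assms by (intro prod.mono_neutral_cong_left) (auto simp: supp2_def)
qed

text \<open>Only sequences with \<nu> in \<open>D\<close> contribute, which makes the sum finite.
  Grouping them by weight \<open>n\<close> pairs the coefficient of degree \<open>K - n\<close> of
  the binomial series with the coefficient of degree \<open>n\<close> of the negative power, a
  Cauchy product.\<close>

lemma F_eq_fps_nth:
  assumes "c 1 \<noteq> 0" "1 \<le> a" "a \<le> Suc r"
  shows "F \<alpha> c x r a = (-1) ^ Suc r * Lpow \<alpha> x * fact r / fact (a - 1) *
    fps_nth (binomial_series \<alpha> x * inverse (Abs_fps (\<lambda>i. c (Suc i))) ^ Suc r) (Suc r - a)"
proof -
  define I where "I = {2..Suc r}"
  have I: "finite I" "I \<subseteq> {2..}" by (auto simp: I_def)
  define K where "K = Suc r - a"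
  have Kr: "K \<le> r" using assms by (simp add: K_def)
  define D where "D = bounded_weight I K"
  have finD: "finite D" unfolding D_def by (rule finite_bounded_weight[OF I])
  define \<Phi> where "\<Phi> = inverse (Abs_fps (\<lambda>i. c (Suc i))) ^ Suc r"
  \<comment> \<open>Restores the first entry from the condition that all entries sum to
    \<open>r\<close>.\<close>
  define E where "E \<nu> = \<nu>(1 := r - sum \<nu> I)" for \<nu> :: "nat \<Rightarrow> nat"
  have D1: "\<nu> 1 = 0" "\<nu> 0 = 0" "sum \<nu> I \<le> r" "supp2 (E \<nu>) \<subseteq> I" "(E \<nu>)(1 := 0) = \<nu>"
      "weight \<nu> I \<le> K" "E \<nu> 1 = r - sum \<nu> I" "\<forall>i. i \<notin> I \<longrightarrow> \<nu> i = 0" if "\<nu> \<in> D" for \<nu>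
  proof -
    show supp: "\<forall>i. i \<notin> I \<longrightarrow> \<nu> i = 0" and w: "weight \<nu> I \<le> K"
      using that by (auto simp: D_def bounded_weight_def)
    show "\<nu> 1 = 0" "\<nu> 0 = 0" using supp by (auto simp: I_def)
    then show "(E \<nu>)(1 := 0) = \<nu>" by (auto simp: E_def)
    show "sum \<nu> I \<le> r" using sum_le_weight[OF I(2), of \<nu>] w Kr by linarith
    show "supp2 (E \<nu>) \<subseteq> I" using supp by (auto simp: supp2_def E_def)
    show "E \<nu> 1 = r - sum \<nu> I" by (simp add: E_def)
  qed
  have injE: "inj_on E D" by (metis D1(5) inj_onI)
  have E_in: "E ` D \<subseteq> Cseq r"
  proof
    fix \<mu> assume "\<mu> \<in> E ` D"
    then obtain \<nu> where \<nu>: "\<nu> \<in> D" "\<mu> = E \<nu>" by blast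
    have sub: "{i. \<mu> i \<noteq> 0} \<subseteq> insert 1 I" using D1(8)[OF \<nu>(1)] \<nu>(2) by (auto simp: E_def)
    have "(\<Sum>i\<in>{i. \<mu> i \<noteq> 0}. \<mu> i) = sum \<mu> (insert 1 I)"
      using sub I by (intro sum.mono_neutral_left) auto
    also have "\<dots> = (r - sum \<nu> I) + sum \<mu> I"
      using I by (subst sum.insert) (auto simp: \<nu> E_def)
    also have "sum \<mu> I = sum \<nu> I" using I by (intro sum.cong) (auto simp: \<nu> E_def)
    finally have "(\<Sum>i\<in>{i. \<mu> i \<noteq> 0}. \<mu> i) = r" using D1(3)[OF \<nu>(1)] by simp
    moreover have "\<mu> 0 = 0" using D1(2)[OF \<nu>(1)] \<nu> by (simp add: E_def)
    moreover have "finite {i. \<mu> i \<noteq> 0}" using sub I finite_subset by blast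
    ultimately show "\<mu> \<in> Cseq r" by (simp add: Cseq_def)
  qed
  have vanish: "Fterm \<alpha> c x r a \<mu> = 0" if \<mu>: "\<mu> \<in> Cseq r" "\<mu> \<notin> E ` D" for \<mu>
  proof -
    define k where "k = int r - (\<Sum>i\<in>supp2 \<mu>. (int i - 1) * int (\<mu> i)) - (int a - 1)"
    have "k < 0"
    proof (rule ccontr)
      assume "\<not> k < 0"
      then have le: "(\<Sum>i\<in>supp2 \<mu>. (int i - 1) * int (\<mu> i)) \<le> int K"
        using assms by (simp add: k_def K_def)
      have fin: "finite {i. \<mu> i \<noteq> 0}" and tot: "(\<Sum>i\<in>{i. \<mu> i \<noteq> 0}. \<mu> i) = r" and \<mu>0: "\<mu> 0 = 0"
        using \<mu> by (auto simp: Cseq_def)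
      have fin2: "finite (supp2 \<mu>)" by (rule finite_subset[OF _ fin]) (auto simp: supp2_def)
      have sub: "supp2 \<mu> \<subseteq> I"
      proof
        fix i assume i: "i \<in> supp2 \<mu>"
        \<comment> \<open>A single index of the support already contributes \<open>i - 1\<close> to
          a sum bounded by \<open>K\<close>, hence by \<open>r\<close>, so it is at most
          \<open>Suc r\<close>.\<close>
        have "int i - 1 \<le> (int i - 1) * int (\<mu> i)"
          using i by (auto simp: supp2_def mult_le_cancel_left1)
        also have "\<dots> \<le> (\<Sum>i\<in>supp2 \<mu>. (int i - 1) * int (\<mu> i))"
          using i fin2 by (intro member_le_sum) (auto simp: supp2_def)
        finally have "int i - 1 \<le> int K" using le by linarith
        then show "i \<in> I" using i Kr by (auto simp: I_def supp2_def)
      qed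
      note W = supp2_weight[OF sub[unfolded I_def], folded I_def]
      let ?\<nu> = "\<mu>(1 := 0)"
      have "?\<nu> i = 0" if "i \<notin> I" for i
      proof (cases "i = 0 \<or> i = 1")
        case False
        then have "2 \<le> i" by linarith
        with sub that show ?thesis by (auto simp: supp2_def)
      qed (use \<mu>0 in auto)
      moreover have "weight ?\<nu> I \<le> K" using le W(2) by simp
      ultimately have "?\<nu> \<in> D" by (simp add: D_def bounded_weight_def)
      moreover have "E ?\<nu> = \<mu>"
      proof -
        have "(\<Sum>i\<in>{i. \<mu> i \<noteq> 0}. \<mu> i) = (\<Sum>i\<in>insert 1 (supp2 \<mu>). \<mu> i)"
        proof (rule sum.mono_neutral_left)
          show "{i. \<mu> i \<noteq> 0} \<subseteq> insert 1 (supp2 \<mu>)"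
          proof
            fix i assume "i \<in> {i. \<mu> i \<noteq> 0}"
            then have "\<mu> i \<noteq> 0" "i \<noteq> 0" using \<mu>0 by (auto intro: gr0I)
            then show "i \<in> insert 1 (supp2 \<mu>)" by (auto simp: supp2_def)
          qed
        qed (use fin2 in \<open>auto simp: supp2_def\<close>)
        also have "\<dots> = \<mu> 1 + sum ?\<nu> I"
          using fin2 W(1) by (subst sum.insert) (auto simp: supp2_def)
        finally have "\<mu> 1 = r - sum ?\<nu> I" using tot by simp
        then show ?thesis by (auto simp: E_def)
      qed
      ultimately show False using \<mu>(2) by (metis imageI)
    qed
    then show ?thesis by (simp add: Fterm_def Let_def gbinom_def k_def)
  qed
  have Fterm_E: "Fterm \<alpha> c x r a (E \<nu>) = (-1) ^ r *
      (fps_nth (binomial_series \<alpha> x) (K - weight \<nu> I) * inverse_power_term c r \<nu> I)" if \<nu>: "\<nu> \<in> D" for \<nu>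
  proof -
    note W = supp2_weight[OF D1(4)[OF \<nu>, unfolded I_def], folded I_def, unfolded D1(5)[OF \<nu>]]
    have k: "int r - int (weight \<nu> I) - (int a - 1) = int (K - weight \<nu> I)"
      using D1(6)[OF \<nu>] assms by (simp add: K_def of_nat_diff)
    have sgn: "(-1 :: complex) ^ (r - sum \<nu> I) = (-1) ^ r * (-1) ^ sum \<nu> I"
      using D1(3)[OF \<nu>] by (simp add: power_diff minus_one_power_iff)
    show ?thesis
      unfolding Fterm_def Let_def W k D1(7)[OF \<nu>] sgn
      by (simp add: gbinom_def binomial_series_nth inverse_power_term_def)
  qed
  have "(\<Sum>\<^sub>\<infinity>\<mu>\<in>Cseq r. Fterm \<alpha> c x r a \<mu>) = (\<Sum>\<^sub>\<infinity>\<mu>\<in>E ` D. Fterm \<alpha> c x r a \<mu>)"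
    using E_in vanish by (intro infsum_cong_neutral) auto
  also have "\<dots> = (\<Sum>\<nu>\<in>D. Fterm \<alpha> c x r a (E \<nu>))"
    using finD injE by (simp add: sum.reindex)
  also have "\<dots> = (-1) ^ r *
      (\<Sum>\<nu>\<in>D. fps_nth (binomial_series \<alpha> x) (K - weight \<nu> I) * inverse_power_term c r \<nu> I)"
    by (simp add: Fterm_E sum_distrib_left)
  also have "(\<Sum>\<nu>\<in>D. fps_nth (binomial_series \<alpha> x) (K - weight \<nu> I) * inverse_power_term c r \<nu> I) =
      (\<Sum>n\<le>K. \<Sum>\<nu>\<in>{\<nu>\<in>D. weight \<nu> I = n}.
        fps_nth (binomial_series \<alpha> x) (K - weight \<nu> I) * inverse_power_term c r \<nu> I)"
    using finD D1(6) by (intro sum.group[symmetric]) auto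
  also have "\<dots> = (\<Sum>n\<le>K. fps_nth (binomial_series \<alpha> x) (K - n) * (fact r * fps_nth \<Phi> n))"
  proof (rule sum.cong)
    fix n assume "n \<in> {..K}"
    then have coeff: "fact r * fps_nth \<Phi> n =
        (\<Sum>\<nu>\<in>{\<nu>\<in>D. weight \<nu> I = n}. inverse_power_term c r \<nu> I)"
      using fps_nth_inverse_power_expansion[of c n K r] assms(1) Kr
      by (simp add: \<Phi>_def D_def I_def)
    show "(\<Sum>\<nu>\<in>{\<nu>\<in>D. weight \<nu> I = n}.
        fps_nth (binomial_series \<alpha> x) (K - weight \<nu> I) * inverse_power_term c r \<nu> I) =
        fps_nth (binomial_series \<alpha> x) (K - n) * (fact r * fps_nth \<Phi> n)"
      unfolding coeff sum_distrib_left by (rule sum.cong) auto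
  qed simp
  also have "\<dots> = fact r * fps_nth (\<Phi> * binomial_series \<alpha> x) K"
    by (simp add: fps_mult_nth sum_distrib_left mult_ac atMost_atLeast0)
  finally show ?thesis
    by (simp add: F_def \<Phi>_def K_def mult_ac del: power_Suc) simp
qed

text \<open>This is the series \<open>h\<close> of the overview: \<open>Lpow \<alpha> x\<close>
  times \<open>binomial_series \<alpha> x\<close> expands \<open>(\<alpha> + w)^x\<close>, and the
  inverted series is \<open>\<phi>(w) / w\<close>, with constant term \<open>c 1\<close>.\<close>

definition block_series :: "Lpt \<Rightarrow> (nat \<Rightarrow> complex) \<Rightarrow> complex \<Rightarrow> complex fps" where
  "block_series \<alpha> c x =
     fps_const (- Lpow \<alpha> x) * binomial_series \<alpha> x * inverse (Abs_fps (\<lambda>i. c (Suc i)))"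

text \<open>The exponents add, so the product depends on the \<open>x m\<close> only through their
  sum, as the arguments of \<open>F\<close> do.\<close>

lemma prod_block_series:
  assumes "finite B"
  shows "(\<Prod>m\<in>B. block_series \<alpha> c (x m)) =
    fps_const ((-1) ^ card B * Lpow \<alpha> (\<Sum>m\<in>B. x m)) *
    (binomial_series \<alpha> (\<Sum>m\<in>B. x m) * inverse (Abs_fps (\<lambda>i. c (Suc i))) ^ card B)"
proof -
  have "(\<Prod>m\<in>B. fps_const (- Lpow \<alpha> (x m))) = fps_const (\<Prod>m\<in>B. - Lpow \<alpha> (x m))"
    using assms by (induction B rule: finite_induct) simp_all
  then show ?thesis
    using assms by (simp add: block_series_def prod.distrib binomial_series_sum Lpow_sum prod_uminus mult.assoc)
qed

text \<open>Serves both sides of the theorem: with \<open>a = 1\<close> for each block, and with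
  general \<open>a\<close> for the whole of \<open>{1..M}\<close>.\<close>

lemma F_eq_forest_weight:
  assumes "c 1 \<noteq> 0" "finite B" "1 \<le> a" "a \<le> card B"
  shows "F \<alpha> c (\<Sum>m\<in>B. x m) (card B - 1) a = forest_weight (\<lambda>m. block_series \<alpha> c (x m)) a B / fact a"
proof -
  obtain r where r: "card B = Suc r" using assms by (cases "card B") auto
  have "fact a = of_nat a * (fact (a - 1) :: complex)"
    using assms(3) by (simp add: fact_reduce)
  moreover have "B \<noteq> {}" using r by auto
  ultimately show ?thesis
    using assms F_eq_fps_nth[of c a r \<alpha> "\<Sum>m\<in>B. x m"]
    by (simp add: forest_weight_def r prod_block_series del: power_Suc)
qed

theorem theorem3p3:
  fixes \<alpha> :: Lpt and c :: "nat \<Rightarrow> complex" and x :: "nat \<Rightarrow> complex" and M a :: nat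
  assumes "in_L \<alpha>" and "c 1 \<noteq> 0" and "1 \<le> a" and "a \<le> M"
  shows "(\<Sum>ss\<in>Spart M a. \<Prod>i<a. F \<alpha> c (\<Sum>m\<in>ss ! i. x m) (card (ss ! i) - 1) 1)
         = F \<alpha> c (\<Sum>i=1..M. x i) (M - 1) a"
proof -
  define h where "h = (\<lambda>m. block_series \<alpha> c (x m))"
  have part: "Spart M a = ordered_partitions {1..M} a"
    by (simp add: Spart_def ordered_partitions_def)
  have "(\<Sum>ss\<in>Spart M a. \<Prod>i<a. F \<alpha> c (\<Sum>m\<in>ss ! i. x m) (card (ss ! i) - 1) 1) =
      (\<Sum>ss\<in>ordered_partitions {1..M} a. \<Prod>i<a. forest_weight h 1 (ss ! i))"
    unfolding part
  proof (intro sum.cong prod.cong refl)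
    fix ss i assume ss: "ss \<in> ordered_partitions {1..M} a" and i: "i \<in> {..<a}"
    then have "ss ! i \<in> set ss" "\<Union>(set ss) = {1..M}" "ss ! i \<noteq> {}"
      unfolding ordered_partitions_def by auto
    moreover from this have "finite (ss ! i)" by (intro finite_subset[of "ss ! i" "{1..M}"]) auto
    ultimately have "finite (ss ! i)" "1 \<le> card (ss ! i)"
      by (auto simp: Suc_le_eq card_gt_0_iff)
    then show "F \<alpha> c (\<Sum>m\<in>ss ! i. x m) (card (ss ! i) - 1) 1 = forest_weight h 1 (ss ! i)"
      using F_eq_forest_weight[of c "ss ! i" 1 \<alpha> x] assms(2) by (simp add: h_def)
  qed
  also have "\<dots> = forest_weight h a {1..M} / fact a"
    using sum_ordered_partitions_forest_weight[of "{1..M}" a h] by (simp add: field_simps)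
  also have "\<dots> = F \<alpha> c (\<Sum>i=1..M. x i) (M - 1) a"
    using F_eq_forest_weight[of c "{1..M}" a \<alpha> x] assms(2-4)
    by (simp add: h_def)
  finally show ?thesis .
qed

end
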